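(* Let $(a_1,\dots,a_{12})=(1,\beta,-2\beta^{2},5\beta^{3},\beta^{4},10\beta^{5},\beta^{6},5\beta^{7},-2\beta^{8},\beta^{9},\beta^{10},2\beta^{11})$. Then \[ \sum_{k=0}^\infty\frac{1}{\alpha^{12k}}\sum_{j=1}^{12}\frac{a_j}{12k+j}=0. \]
   Context: $\alpha=(1+\sqrt5)/2$ is the golden ratio and $\beta=-1/\alpha=(1-\sqrt5)/2$. *)

theory Defs
  imports "HOL-Analysis.Analysis"
begin

definition golden_alpha :: real where
  "golden_alpha = (1 + sqrt 5) / 2"

definition golden_beta :: real where
  "golden_beta = - 1 / golden_alpha"

lemma golden_beta_altdef: "golden_beta = (1 - sqrt 5) / 2"
proof -
  have "sqrt 5 * sqrt 5 = (5::real)" by simp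
  moreover have "1 + sqrt 5 > (0::real)" by (simp add: add_pos_pos)
  ultimately show ?thesis
    by (simp add: golden_beta_def golden_alpha_def field_simps)
qed

(* The tuple is indexed from 1; only 1 <= j <= 12 is meaningful. *)
definition a_coeff :: "nat \<Rightarrow> real" where
  "a_coeff j =
    [1,
     golden_beta,
     - 2 * golden_beta ^ 2,
     5 * golden_beta ^ 3,
     golden_beta ^ 4,
     10 * golden_beta ^ 5,
     golden_beta ^ 6,
     5 * golden_beta ^ 7,
     - 2 * golden_beta ^ 8,
     golden_beta ^ 9,
     golden_beta ^ 10,
     2 * golden_beta ^ 11] ! (j - 1)"

end

theory Submission
  imports Defs
begin

text \<open>
  Multiplied by \<open>\<beta>\<close>, the series is \<open>\<Sum>n\<ge>1. c n * \<beta>^n / n\<close> with \<open>c\<close> of period 12 and values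
  1, 1, -2, 5, 1, 10, 1, 5, -2, 1, 1, 2. Since \<open>c n\<close> is the sum of the
  \<open>m * e m\<close> over the divisors \<open>m\<close> of \<open>n\<close>, where \<open>e 1 = 1\<close>, \<open>e 3 = -1\<close>, \<open>e 4 = 1\<close>, \<open>e 6 = 2\<close>, \<open>e 12 = -1\<close>
  (and \<open>e m = 0\<close> otherwise), its value is minus the logarithm of
  \<open>(1 - \<beta>) (1 - \<beta>^4) (1 - \<beta>^6)^2 / ((1 - \<beta>^3) (1 - \<beta>^12))\<close>,
  a quotient that equals 1 because \<open>\<beta>^2 = \<beta> + 1\<close>.
\<close>

text \<open>The Mercator series, cut into consecutive blocks of length \<open>p\<close>.\<close>

lemma ln_one_minus_sums_grouped:
  fixes x :: real
  assumes "\<bar>x\<bar> < 1" "p > 0"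
  shows "(\<lambda>k. \<Sum>j = 1..p. x ^ (p * k + j) / real (p * k + j)) sums - ln (1 - x)"
proof -
  have "(\<lambda>n. - ((- (- x)) ^ n) / real n) sums ln (1 + (- x))"
    by (rule ln_series') (use assms in simp)
  from sums_minus[OF this] have "(\<lambda>n. x ^ n / real n) sums - ln (1 - x)"
    by simp
  \<comment> \<open>The dropped term at \<open>n = 0\<close> is \<open>1 / 0 = 0\<close>.\<close>
  hence "(\<lambda>n. x ^ Suc n / real (Suc n)) sums - ln (1 - x)"
    by (subst sums_Suc_iff) simp
  from sums_group[OF this assms(2)]
  have "(\<lambda>k. \<Sum>n = k * p..<k * p + p. x ^ Suc n / real (Suc n)) sums - ln (1 - x)" .
  moreover have "(\<Sum>n = k * p..<k * p + p. x ^ Suc n / real (Suc n)) =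
      (\<Sum>j = 1..p. x ^ (p * k + j) / real (p * k + j))" for k
    by (rule sum.reindex_bij_witness[of _ "\<lambda>j. p * k + j - 1" "\<lambda>n. Suc n - p * k"])
       (auto simp: mult.commute)
  ultimately show ?thesis by simp
qed

text \<open>Expanding the fractions by \<open>m\<close> gives all series with the same
  \<open>m * p\<close> a common prefactor and denominators from one block, so they can be added
  blockwise.\<close>

lemma ln_one_minus_power_sums_grouped:
  fixes x :: real
  assumes "\<bar>x\<bar> < 1" "m > 0" "p > 0"
  shows "(\<lambda>k. x ^ (m * p * k) * (\<Sum>j = 1..p. real m * x ^ (m * j) / real (m * p * k + m * j)))
           sums - ln (1 - x ^ m)"
proof -
  have "\<bar>x ^ m\<bar> < 1"
    using assms by (simp add: power_abs power_less_one_iff)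
  from ln_one_minus_sums_grouped[OF this assms(3)]
  have "(\<lambda>k. \<Sum>j = 1..p. (x ^ m) ^ (p * k + j) / real (p * k + j)) sums - ln (1 - x ^ m)" .
  moreover have "(x ^ m) ^ (p * k + j) / real (p * k + j) =
      x ^ (m * p * k) * (real m * x ^ (m * j) / real (m * p * k + m * j))" for k j
  proof -
    have "real (m * p * k + m * j) = real m * real (p * k + j)"
      by (simp add: algebra_simps)
    moreover have "(x ^ m) ^ (p * k + j) = x ^ (m * p * k) * x ^ (m * j)"
      by (simp add: algebra_simps flip: power_add power_mult)
    ultimately show ?thesis using assms(2) by simp
  qed
  ultimately show ?thesis by (simp add: sum_distrib_left)
qed

lemma golden_beta_square: "golden_beta ^ 2 = golden_beta + 1"
  by (simp add: golden_beta_altdef power2_eq_square field_simps)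

lemma golden_beta_bounds: "-1 < golden_beta" "golden_beta < 0"
proof -
  have "sqrt 5 < 3" by (rule real_less_lsqrt) auto
  moreover have "1 < sqrt (5::real)" by simp
  ultimately show "-1 < golden_beta" "golden_beta < 0"
    by (auto simp: golden_beta_altdef)
qed

text \<open>The exponent is even, so the sign in \<beta> = -1/\<alpha> disappears.\<close>

lemma inverse_golden_alpha_power: "1 / golden_alpha ^ (12 * k) = golden_beta ^ (12 * k)"
  by (simp add: golden_beta_def power_divide power_mult)

lemma golden_beta_cyclotomic:
  defines "b \<equiv> golden_beta"
  shows "(1 - b) * (1 - b ^ 4) * (1 - b ^ 6) ^ 2 = (1 - b ^ 3) * (1 - b ^ 12)"
proof -
  have b2: "b ^ 2 = b + 1" by (simp add: b_def golden_beta_square)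
  \<comment> \<open>The coefficients are Fibonacci numbers: \<open>b ^ n\<close> is F(n)
    \<open>b\<close> + F(n-1).\<close>
  have b3: "b ^ 3 = 2 * b + 1" and b4: "b ^ 4 = 3 * b + 2" and b6: "b ^ 6 = 8 * b + 5"
    using b2 by algebra+
  have b12: "b ^ 12 = (b ^ 6) ^ 2" by simp
  show ?thesis unfolding b12 b6 b4 b3 using b2 by algebra
qed

text \<open>Every factor is positive since \<open>\<bar>b\<bar> < 1\<close>, so the logarithm of the
  product identity splits.\<close>

lemma ln_golden_beta_relation:
  defines "b \<equiv> golden_beta"
  shows "ln (1 - b) + ln (1 - b ^ 4) + 2 * ln (1 - b ^ 6) = ln (1 - b ^ 3) + ln (1 - b ^ 12)"
proof -
  have pos: "1 - b ^ m > 0" if "m > 0" for m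
  proof -
    have "\<bar>b ^ m\<bar> < 1"
      using golden_beta_bounds that by (simp add: b_def power_abs power_less_one_iff)
    thus ?thesis by linarith
  qed
  have "ln ((1 - b) * (1 - b ^ 4) * (1 - b ^ 6) ^ 2) = ln ((1 - b ^ 3) * (1 - b ^ 12))"
    unfolding b_def golden_beta_cyclotomic ..
  thus ?thesis
    using pos[of 1] pos[of 3] pos[of 4] pos[of 6] pos[of 12]
    by (simp add: ln_mult ln_realpow)
qed

theorem theorem5p6:
  shows "(\<lambda>k::nat. 1 / golden_alpha ^ (12 * k) *
           (\<Sum>j = 1..12. a_coeff j / real (12 * k + j))) sums 0"
proof -
  define b where "b = golden_beta"
  have b: "\<bar>b\<bar> < 1" "b \<noteq> 0" using golden_beta_bounds by (auto simp: b_def)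
  define T where "T m p k = b ^ (m * p * k) *
    (\<Sum>j = 1..p. real m * b ^ (m * j) / real (m * p * k + m * j))" for m p k
  have T: "T m p sums - ln (1 - b ^ m)" if "m > 0" "p > 0" for m p
    unfolding T_def by (rule ln_one_minus_power_sums_grouped[OF b(1) that])
  \<comment> \<open>Each \<open>T m p\<close> has \<open>m * p = 12\<close> and enters with weight
    \<open>e m\<close>.\<close>
  have "(\<lambda>k. T 1 12 k + T 4 3 k + 2 * T 6 2 k - T 3 4 k - T 12 1 k) sums
      (- ln (1 - b ^ 1) + - ln (1 - b ^ 4) + 2 * - ln (1 - b ^ 6) - - ln (1 - b ^ 3)
        - - ln (1 - b ^ 12))"
    by (intro sums_add sums_diff sums_mult T) auto
  also have "\<dots> = 0"
    using ln_golden_beta_relation by (simp add: b_def)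
  \<comment> \<open>Dividing by \<open>b\<close> lowers \<open>b ^ j\<close> to the power
    \<open>b ^ (j - 1)\<close> found in \<open>a_coeff j\<close>.\<close>
  finally have "(\<lambda>k. (T 1 12 k + T 4 3 k + 2 * T 6 2 k - T 3 4 k - T 12 1 k) / b) sums (0 / b)"
    by (rule sums_divide)
  moreover have "(T 1 12 k + T 4 3 k + 2 * T 6 2 k - T 3 4 k - T 12 1 k) / b =
      1 / golden_alpha ^ (12 * k) * (\<Sum>j = 1..12. a_coeff j / real (12 * k + j))" for k
  proof -
    \<comment> \<open>With the reciprocals kept as atoms \<open>d j\<close>, only their coefficients
      need comparing; at \<open>j = 12\<close> this is 1 + 4 + 12 - 3 - 12 = 2.\<close>
    define d where "d j = inverse (real (12 * k + j))" for j
    have "T 1 12 k + T 4 3 k + 2 * T 6 2 k - T 3 4 k - T 12 1 k =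
        b ^ (12 * k) * ((\<Sum>j = 1..12. b ^ j * d j) + (\<Sum>j = 1..3. 4 * b ^ (4 * j) * d (4 * j))
          + 2 * (\<Sum>j = 1..2. 6 * b ^ (6 * j) * d (6 * j))
          - (\<Sum>j = 1..4. 3 * b ^ (3 * j) * d (3 * j)) - 12 * b ^ 12 * d 12)"
      by (simp add: T_def d_def divide_inverse algebra_simps)
    also have "\<dots> = b ^ (12 * k) * (b * (\<Sum>j = 1..12. a_coeff j * d j))"
      by (simp add: numeral_eq_Suc a_coeff_def b_def[symmetric] algebra_simps)
    finally show ?thesis
      unfolding inverse_golden_alpha_power b_def[symmetric] d_def using b(2)
      by (simp add: divide_inverse)
  qed
  ultimately show ?thesis by simp
qed

end
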